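(* Let $\alpha\in(0,1)$ be a quadratic irrational of height $H$, and suppose that $\operatorname{exit}(\alpha)=N<\infty$. Then $$\operatorname{dist}\!\left(\theta_{N-1},\{1/3,2/3\}\right)\ge\frac{1}{9H\,3^{N}}.$$
   Context: $\operatorname{dist}(x,A)=\inf_{y\in A}|x-y|$. Let $M=[1/3,2/3)$. For an irrational $\alpha\in(0,1)$ and an integer $n\ge 0$, $\theta_n=\{3^n\alpha\}$ is the fractional part of $3^n\alpha$. The exit time of $\alpha$ is $\operatorname{exit}(\alpha)=\inf\{N\ge 1:\theta_{N-1}\in M\}\in\mathbb{N}\cup\{\infty\}$ (with $\inf\emptyset=\infty$). The height of a quadratic irrational $\alpha$ is $H=\max\{|a|,|b|,|c|\}$, where $f(x)=ax^2+bx+c\in\mathbb{Z}[x]$ is the primitive irreducible minimal polynomial of $\alpha$. *)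

theory Defs
  imports "HOL-Analysis.Analysis" "HOL-Computational_Algebra.Polynomial_Factorial"
    "HOL-Library.Extended_Nat"
begin

definition quadratic_irrational :: "real \<Rightarrow> bool" where
  "quadratic_irrational \<alpha> \<longleftrightarrow>
     \<alpha> \<notin> \<rat> \<and> (\<exists>p :: int poly. degree p = 2 \<and> poly (map_poly of_int p) \<alpha> = 0)"

definition is_quadratic_minpoly :: "int poly \<Rightarrow> real \<Rightarrow> bool" where
  "is_quadratic_minpoly f \<alpha> \<longleftrightarrow>
     degree f = 2 \<and> content f = 1 \<and> irreducible f \<and> poly (map_poly of_int f) \<alpha> = 0"

(* The primitive minimal polynomial is determined only up to sign, which does not
   affect the height, so an arbitrary choice is harmless. *)
definition quadratic_height :: "real \<Rightarrow> int" where
  "quadratic_height \<alpha> =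
     (let f = (SOME f. is_quadratic_minpoly f \<alpha>)
      in Max {\<bar>coeff f 2\<bar>, \<bar>coeff f 1\<bar>, \<bar>coeff f 0\<bar>})"

definition middle_third :: "real set" where
  "middle_third = {1/3..<2/3}"

definition theta :: "real \<Rightarrow> nat \<Rightarrow> real" where
  "theta \<alpha> n = frac (3 ^ n * \<alpha>)"

(* In enat the infimum of the empty set is \<infinity>. *)
definition exit_time :: "real \<Rightarrow> enat" where
  "exit_time \<alpha> = Inf {enat N | N. N \<ge> 1 \<and> theta \<alpha> (N - 1) \<in> middle_third}"

end

theory Submission
  imports Defs
begin

text \<open>
  The estimate is Liouville's inequality with an explicit constant. Dividing
  the difference between \<open>theta \<alpha> (N - 1)\<close> and \<open>j/3\<close>, where \<open>j\<close> is \<open>1\<close> or \<open>2\<close>, by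
  \<open>3^(N-1)\<close> turns it into the difference between \<open>\<alpha>\<close> and a triadic rational \<open>r = m / 3^N\<close>,
  which again lies in \<open>[0,1]\<close>. If \<open>f = a x\<^sup>2 + b x + c\<close> is the minimal polynomial
  of \<open>\<alpha>\<close>, then \<open>f(r) = f(r) - f(\<alpha>) = (r - \<alpha>) (a (r + \<alpha>) + b)\<close>. Both factors are
  nonzero because \<open>\<alpha>\<close> is irrational, so the integer \<open>9^N f(r)\<close> has absolute
  value at least \<open>1\<close>; and the cofactor is at most \<open>3H\<close> because \<open>r\<close> and \<open>\<alpha>\<close> both
  lie in the unit interval. Hence \<open>\<bar>\<alpha> - r\<bar> \<ge> 1 / (3 H 9^N)\<close>, and scaling back by
  \<open>3^(N-1)\<close> gives the claim.

  The finite exit time guarantees \<open>N \<ge> 1\<close>, so that the truncated difference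
  \<open>N - 1\<close> is a genuine predecessor and the scaling exponents match.
\<close>

lemma poly_of_int_degree_le_2:
  fixes p :: "int poly" and x :: real
  assumes "degree p \<le> 2"
  shows "poly (map_poly of_int p) x
    = of_int (coeff p 2) * x^2 + of_int (coeff p 1) * x + of_int (coeff p 0)"
proof -
  have "degree (map_poly of_int p :: real poly) \<le> 2"
    using assms by (simp add: degree_map_poly)
  then have "(\<Sum>i\<le>2. monom (coeff (map_poly of_int p :: real poly) i) i) = map_poly of_int p"
    by (rule poly_as_sum_of_monoms')
  then have "poly (map_poly of_int p) x
      = (\<Sum>i\<le>2. coeff (map_poly of_int p :: real poly) i * x ^ i)"
    by (metis (no_types, lifting) poly_monom poly_sum sum.cong)
  then show ?thesis
    by (simp add: coeff_map_poly numeral_2_eq_2)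
qed

lemma irrational_not_root_of_linear:
  fixes g :: "int poly" and \<alpha> :: real
  assumes "\<alpha> \<notin> \<rat>" "degree g = 1"
  shows "poly (map_poly of_int g) \<alpha> \<noteq> 0"
proof
  assume root: "poly (map_poly of_int g) \<alpha> = 0"
  have lead: "coeff g 1 \<noteq> 0"
    using assms(2) by (metis leading_coeff_0_iff degree_0 zero_neq_one)
  have "coeff g 2 = 0"
    using assms(2) by (simp add: coeff_eq_0)
  then have "of_int (coeff g 1) * \<alpha> + of_int (coeff g 0) = (0::real)"
    using root poly_of_int_degree_le_2[of g \<alpha>] assms(2) by simp
  then have "\<alpha> = - of_int (coeff g 0) / of_int (coeff g 1)"
    using lead by (simp add: field_simps)
  then have "\<alpha> \<in> \<rat>" by simp
  with assms(1) show False by simp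
qed

text \<open>
  The height is defined through a choice operator, so it says something about
  \<open>\<alpha>\<close> only once a primitive irreducible polynomial is exhibited. The primitive
  part of any quadratic annihilating \<open>\<alpha>\<close> serves: a constant factor of a primitive
  polynomial is a unit, and a splitting into two linear factors would make \<open>\<alpha>\<close>
  rational.
\<close>

lemma quadratic_irrational_has_minpoly:
  assumes "quadratic_irrational \<alpha>"
  shows "\<exists>f. is_quadratic_minpoly f \<alpha>"
proof -
  obtain p :: "int poly" where irr: "\<alpha> \<notin> \<rat>" and deg: "degree p = 2"
    and root: "poly (map_poly of_int p) \<alpha> = 0"
    using assms by (auto simp: quadratic_irrational_def)
  define f where "f = primitive_part p"
  have p0: "p \<noteq> 0" using deg by auto
  have degf: "degree f = 2" using deg by (simp add: f_def)
  have cf: "content f = 1" using p0 by (simp add: f_def)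
  have f0: "f \<noteq> 0" using degf by auto
  have coeff_p: "coeff p i = content p * coeff f i" for i
    unfolding f_def by (metis content_times_primitive_part coeff_smult)
  have "of_int (content p) * poly (map_poly of_int f) \<alpha> = (0::real)"
    using root poly_of_int_degree_le_2[of p \<alpha>] poly_of_int_degree_le_2[of f \<alpha>] deg degf
    by (simp add: coeff_p algebra_simps)
  then have rootf: "poly (map_poly of_int f) \<alpha> = 0"
    using p0 by simp
  have unit: "g dvd 1" if "g dvd f" "degree g = 0" for g
  proof -
    obtain c where c: "g = [:c:]"
      using \<open>degree g = 0\<close> by (metis degree_eq_zeroE)
    have "c dvd content f"
      using \<open>g dvd f\<close> c by (simp add: const_poly_dvd_iff_dvd_content)
    then show ?thesis
      using c cf by (simp add: is_unit_const_poly_iff)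
  qed
  have "irreducible f"
  proof (rule irreducibleI)
    show "f \<noteq> 0" by (fact f0)
    show "\<not> f dvd 1" using degf f0
      by (metis degree_1 dvd_imp_degree_le numeral_le_iff one_neq_zero
          le_zero_eq zero_neq_numeral)
    fix g h assume gh: "f = g * h"
    then have "g \<noteq> 0" "h \<noteq> 0" using f0 by auto
    then have sum: "degree g + degree h = 2"
      using gh degf by (simp add: degree_mult_eq)
    have "map_poly of_int f = (map_poly of_int g * map_poly of_int h :: real poly)"
      unfolding gh by (rule poly_eqI) (simp add: coeff_map_poly coeff_mult)
    then have "poly (map_poly of_int g) \<alpha> = 0 \<or> poly (map_poly of_int h) \<alpha> = 0"
      using rootf by simp
    then have "\<not> (degree g = 1 \<and> degree h = 1)"
      using irrational_not_root_of_linear[OF irr] by blast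
    then have "degree g = 0 \<or> degree h = 0"
      using sum by linarith
    then show "g dvd 1 \<or> h dvd 1"
      using unit gh by auto
  qed
  then show ?thesis
    using degf cf rootf by (auto simp: is_quadratic_minpoly_def)
qed

text \<open>
  This form of the height frees the Diophantine argument from the choice operator
  and from polynomials: all it keeps is an integral quadratic equation for \<open>\<alpha>\<close>
  with controlled coefficients.
\<close>

lemma quadratic_height_equation:
  assumes "quadratic_irrational \<alpha>"
  obtains a b c :: int where "a \<noteq> 0"
    "of_int a * \<alpha>^2 + of_int b * \<alpha> + of_int c = 0"
    "\<bar>a\<bar> \<le> quadratic_height \<alpha>" "\<bar>b\<bar> \<le> quadratic_height \<alpha>"
proof -
  define f where "f = (SOME f. is_quadratic_minpoly f \<alpha>)"
  have min: "is_quadratic_minpoly f \<alpha>"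
    unfolding f_def using quadratic_irrational_has_minpoly[OF assms] by (rule someI_ex)
  then have deg: "degree f = 2" and root: "poly (map_poly of_int f) \<alpha> = 0"
    by (auto simp: is_quadratic_minpoly_def)
  have height: "quadratic_height \<alpha> = Max {\<bar>coeff f 2\<bar>, \<bar>coeff f 1\<bar>, \<bar>coeff f 0\<bar>}"
    by (simp add: quadratic_height_def f_def Let_def)
  have "coeff f 2 \<noteq> 0"
    using deg by (metis leading_coeff_0_iff degree_0 zero_neq_numeral)
  moreover have "of_int (coeff f 2) * \<alpha>^2 + of_int (coeff f 1) * \<alpha> + of_int (coeff f 0) = 0"
    using root poly_of_int_degree_le_2[of f \<alpha>] deg by simp
  ultimately show thesis
    by (rule that) (simp_all add: height)
qed

text \<open>
  The quadratic takes at \<open>m/q\<close> the value \<open>(m/q - \<alpha>) (a (m/q + \<alpha>) + b)\<close>. If either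
  factor vanished, \<open>\<alpha>\<close> would be rational; so this value, a multiple of \<open>1/q\<^sup>2\<close>, is
  at least \<open>1/q\<^sup>2\<close> in size, and dividing by the cofactor bounds \<open>\<bar>m/q - \<alpha>\<bar>\<close>. The
  constant \<open>3\<close> counts the two occurrences of \<open>a\<close> and the one of \<open>b\<close> in that
  cofactor, each weighted by a number of the unit interval.
\<close>

lemma quadratic_liouville_unit_interval:
  fixes \<alpha> :: real and a b c H m q :: int
  assumes irr: "\<alpha> \<notin> \<rat>" and "0 \<le> \<alpha>" "\<alpha> \<le> 1"
    and a0: "a \<noteq> 0" and root: "of_int a * \<alpha>^2 + of_int b * \<alpha> + of_int c = 0"
    and aH: "\<bar>a\<bar> \<le> H" and bH: "\<bar>b\<bar> \<le> H"
    and "0 < q" "0 \<le> m" "m \<le> q"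
  shows "\<bar>\<alpha> - of_int m / of_int q\<bar> \<ge> 1 / (3 * of_int H * (of_int q)^2)"
proof -
  define r where "r = (of_int m / of_int q :: real)"
  define t where "t = of_int a * (r + \<alpha>) + (of_int b :: real)"
  define z where "z = a * m^2 + b * m * q + c * q^2"
  have r: "0 \<le> r" "r \<le> 1" and r_rat: "r \<in> \<rat>"
    using assms by (auto simp: r_def)
  have H: "real_of_int H > 0" using a0 aH by linarith
  have m: "real_of_int m = r * of_int q"
    using \<open>0 < q\<close> by (simp add: r_def)
  have "(r - \<alpha>) * t = of_int a * r^2 + of_int b * r + of_int c
      - (of_int a * \<alpha>^2 + of_int b * \<alpha> + of_int c)"
    by (simp add: t_def algebra_simps power2_eq_square)
  then have factor: "(r - \<alpha>) * t = of_int a * r^2 + of_int b * r + of_int c"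
    using root by simp
  have z_eq: "real_of_int z = (r - \<alpha>) * t * (of_int q)^2"
    unfolding factor z_def by (simp add: m algebra_simps power2_eq_square)
  have "t \<noteq> 0"
  proof
    assume "t = 0"
    then have "\<alpha> = - of_int b / of_int a - r"
      using a0 by (simp add: t_def field_simps)
    then have "\<alpha> \<in> \<rat>" using r_rat by simp
    with irr show False by simp
  qed
  moreover have "r \<noteq> \<alpha>" using irr r_rat by auto
  ultimately have "real_of_int z \<noteq> 0"
    unfolding z_eq using \<open>0 < q\<close> by simp
  then have "\<bar>z\<bar> \<ge> 1" by simp
  then have "1 \<le> \<bar>real_of_int z\<bar>" by linarith
  then have "1 \<le> \<bar>\<alpha> - r\<bar> * \<bar>t\<bar> * (of_int q)^2"
    unfolding z_eq by (simp add: abs_mult abs_minus_commute)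
  also have "\<dots> \<le> \<bar>\<alpha> - r\<bar> * (3 * of_int H) * (of_int q)^2"
  proof -
    have "\<bar>of_int a * (r + \<alpha>)\<bar> \<le> of_int H * (2::real)"
      unfolding abs_mult using aH H r assms by (intro mult_mono) auto
    moreover have "\<bar>real_of_int b\<bar> \<le> of_int H" using bH by linarith
    ultimately have "\<bar>t\<bar> \<le> 3 * of_int H" unfolding t_def by linarith
    then show ?thesis by (intro mult_right_mono mult_left_mono) auto
  qed
  finally show ?thesis
    using H \<open>0 < q\<close> by (simp add: r_def divide_simps mult_ac)
qed

text \<open>
  The numerator \<open>3 \<lfloor>3^n \<alpha>\<rfloor> + j\<close> stays in \<open>[0, 3^(n+1)]\<close> exactly because \<open>\<alpha>\<close> and
  \<open>j/3\<close> lie in the unit interval, so the Liouville bound applies at \<open>q = 3^(n+1)\<close>;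
  one of the two factors \<open>3^(n+1)\<close> of \<open>q\<^sup>2\<close> is lost to the dilation by \<open>3^n\<close>, at the
  cost of turning the constant \<open>3\<close> into \<open>9\<close>.
\<close>

lemma theta_distance_third:
  fixes \<alpha> :: real and j :: int
  assumes "0 < \<alpha>" "\<alpha> < 1" and quad: "quadratic_irrational \<alpha>" and "0 \<le> j" "j \<le> 3"
  shows "\<bar>theta \<alpha> n - of_int j / 3\<bar> \<ge> 1 / (9 * of_int (quadratic_height \<alpha>) * 3 ^ Suc n)"
proof -
  obtain a b c :: int where eq: "a \<noteq> 0"
    "of_int a * \<alpha>^2 + of_int b * \<alpha> + of_int c = 0"
    "\<bar>a\<bar> \<le> quadratic_height \<alpha>" "\<bar>b\<bar> \<le> quadratic_height \<alpha>"
    using quadratic_height_equation[OF quad] by metis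
  have irr: "\<alpha> \<notin> \<rat>" using quad by (simp add: quadratic_irrational_def)
  define k where "k = \<lfloor>3 ^ n * \<alpha>\<rfloor>"
  have "0 \<le> k" using \<open>0 < \<alpha>\<close> by (simp add: k_def)
  have "3 ^ n * \<alpha> < of_int (3 ^ n)" using \<open>\<alpha> < 1\<close> by simp
  then have "k < 3 ^ n" unfolding k_def by (simp only: floor_less_iff)
  define m where "m = 3 * k + j"
  have "0 \<le> m" "m \<le> 3 ^ Suc n"
    using \<open>0 \<le> k\<close> \<open>k < 3 ^ n\<close> assms by (auto simp: m_def)
  then have "1 / (3 * of_int (quadratic_height \<alpha>) * (of_int (3 ^ Suc n))^2)
      \<le> \<bar>\<alpha> - of_int m / of_int (3 ^ Suc n)\<bar>"
    using assms irr eq by (intro quadratic_liouville_unit_interval[OF _ _ _ eq(1,2)]) auto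
  then have "3 ^ n * (1 / (3 * of_int (quadratic_height \<alpha>) * (3 ^ Suc n)^2))
      \<le> 3 ^ n * \<bar>\<alpha> - of_int m / 3 ^ Suc n\<bar>"
    by (intro mult_left_mono) auto
  also have "3 ^ n * \<bar>\<alpha> - of_int m / 3 ^ Suc n\<bar> = \<bar>3 ^ n * (\<alpha> - of_int m / 3 ^ Suc n)\<bar>"
    by (simp add: abs_mult)
  also have "3 ^ n * (\<alpha> - of_int m / 3 ^ Suc n) = theta \<alpha> n - of_int j / 3"
    by (simp add: theta_def frac_def m_def k_def field_simps)
  finally show ?thesis
    by (simp add: power2_eq_square)
qed

lemma exit_time_positive:
  assumes "exit_time \<alpha> = enat N"
  shows "1 \<le> N"
proof -
  have "enat 1 \<le> exit_time \<alpha>"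
    unfolding exit_time_def by (rule Inf_greatest) auto
  then show ?thesis using assms by simp
qed

theorem lemma3p2:
  fixes \<alpha> :: real and H :: int and N :: nat
  assumes "0 < \<alpha>" and "\<alpha> < 1"
    and "quadratic_irrational \<alpha>"
    and "H = quadratic_height \<alpha>"
    and "exit_time \<alpha> = enat N"
  shows "infdist (theta \<alpha> (N - 1)) {1/3, 2/3} \<ge> 1 / (9 * real_of_int H * 3 ^ N)"
proof -
  have N: "Suc (N - 1) = N" using exit_time_positive[OF assms(5)] by simp
  have bound: "1 / (9 * real_of_int H * 3 ^ N) \<le> \<bar>theta \<alpha> (N - 1) - of_int j / 3\<bar>"
    if "0 \<le> j" "j \<le> 3" for j
    using theta_distance_third[OF assms(1-3) that, of "N - 1"] unfolding N assms(4) .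
  have "1 / (9 * real_of_int H * 3 ^ N) \<le> dist (theta \<alpha> (N - 1)) y" if "y \<in> {1/3, 2/3}" for y
    using that bound[of 1] bound[of 2] by (auto simp: dist_real_def)
  then show ?thesis
    unfolding infdist_def by (auto simp del: image_insert intro!: cINF_greatest)
qed

end
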